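(* Let $D(x)=1-2x-2x^2+x^3$ and define integer sequences by the formal power series expansions \[ \frac{8+8x+24x^2}{D(x)}=\sum_{n\ge0}a_nx^n,\ \frac{6-68x+18x^2}{D(x)}=\sum_{n\ge0}b_nx^n,\ \frac{14-60x+42x^2}{D(x)}=\sum_{n\ge0}c_nx^n, \] \[ \frac{9+18x-27x^2}{D(x)}=\sum_{n\ge0}d_nx^n,\ \frac{4+8x-12x^2}{D(x)}=\sum_{n\ge0}e_nx^n,\ \frac{15+30x-45x^2}{D(x)}=\sum_{n\ge0}f_nx^n. \] Then for all $n\ge0$, $a_n^4+b_n^4+c_n^4+d_n^4+e_n^4=f_n^4$. *)

theory Defs
  imports "HOL-Computational_Algebra.Formal_Power_Series"
begin

text \<open>
  The quotients are taken in the ring of formal power series over the rationals, since the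
  library provides division of power series only over a type with inverses. The constant
  coefficient of \<open>D\<close> is 1, so \<open>D\<close> is invertible and the quotients are genuine. That the
  coefficients are integers is thus not visible from the types.
\<close>

definition D :: "rat fps" where
  "D = 1 - 2 * fps_X - 2 * fps_X ^ 2 + fps_X ^ 3"

definition a_seq :: "nat \<Rightarrow> rat" where
  "a_seq n = fps_nth ((8 + 8 * fps_X + 24 * fps_X ^ 2) / D) n"

definition b_seq :: "nat \<Rightarrow> rat" where
  "b_seq n = fps_nth ((6 - 68 * fps_X + 18 * fps_X ^ 2) / D) n"

definition c_seq :: "nat \<Rightarrow> rat" where
  "c_seq n = fps_nth ((14 - 60 * fps_X + 42 * fps_X ^ 2) / D) n"

definition d_seq :: "nat \<Rightarrow> rat" where
  "d_seq n = fps_nth ((9 + 18 * fps_X - 27 * fps_X ^ 2) / D) n"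

definition e_seq :: "nat \<Rightarrow> rat" where
  "e_seq n = fps_nth ((4 + 8 * fps_X - 12 * fps_X ^ 2) / D) n"

definition f_seq :: "nat \<Rightarrow> rat" where
  "f_seq n = fps_nth ((15 + 30 * fps_X - 45 * fps_X ^ 2) / D) n"

end

(* D factors as (1 + x)(1 - 3 x + x^2), whose roots are -1 and the inverse squares of the Fibonacci
   roots, and 1/D = sum_n F(n+1) F(n+2) x^n. So each sequence is a binary quadratic form in
   x = F(n), y = F(n+1), and the claim becomes a polynomial identity in x and y: here c = a + b
   and (d, e, f) = (9 t, 4 t, 15 t) with t = 3 x^2 + y^2, the identity a^4 + b^4 + (a+b)^4 =
   2 (a^2 + a b + b^2)^2 applies, and a^2 + a b + b^2 = 148 t^2, while
   15^4 - 9^4 - 4^4 = 2 * 148^2. *)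

theory Submission
  imports Defs "HOL-Number_Theory.Fib"
begin

text \<open>The factor of \<open>r\<close> is F(n-1) F(n), written without a predecessor so that it
  vanishes at n = 0.\<close>

lemma fps_quadratic_over_D:
  "(fps_const p + fps_const q * fps_X + fps_const r * fps_X ^ 2) / D =
     Abs_fps (\<lambda>n. p * (of_nat (fib (Suc n)) * of_nat (fib (Suc (Suc n))))
       + q * (of_nat (fib n) * of_nat (fib (Suc n)))
       + r * (of_nat (fib n) * (of_nat (fib (Suc n)) - of_nat (fib n))))"
  (is "?N / D = ?F")
proof -
  have D_poly: "D = 1 - fps_const 2 * fps_X - fps_const 2 * fps_X ^ 2 + fps_X ^ 3"
    by (simp add: D_def numeral_fps_const)
  have "?F * D = ?N"
  proof (rule fps_ext)
    fix n :: nat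
    have expand: "G * D = G - fps_const 2 * (G * fps_X) - fps_const 2 * (G * fps_X ^ 2)
        + G * fps_X ^ 3" for G :: "rat fps"
      unfolding D_poly by (simp add: algebra_simps)
    \<comment> \<open>Indices 0 to 2 yield the numerator; beyond, u(n) = 2 u(n-1) + 2 u(n-2) -
      u(n-3) holds for products of consecutive Fibonacci numbers.\<close>
    consider "n = 0" | "n = Suc 0" | "n = Suc (Suc 0)" | m where "n = Suc (Suc (Suc m))"
      by (metis not0_implies_Suc)
    then show "fps_nth (?F * D) n = fps_nth ?N n"
      unfolding expand
      by cases (simp_all add: fps_X_power_mult_right_nth, simp_all add: algebra_simps)
  qed
  moreover have "fps_nth D 0 \<noteq> 0"
    by (simp add: D_def)
  then have "D \<noteq> 0"
    by auto
  ultimately show ?thesis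
    using nonzero_mult_div_cancel_right[of D ?F] by simp
qed

text \<open>Substitute F(n+2) = \<open>x + y\<close>.\<close>

lemma fps_quadratic_over_D_nth:
  fixes p q r :: int and n :: nat
  defines "x \<equiv> of_nat (fib n) :: rat" and "y \<equiv> of_nat (fib (Suc n))"
  shows "fps_nth ((of_int p + of_int q * fps_X + of_int r * fps_X ^ 2) / D) n =
    of_int p * y\<^sup>2 + of_int (p + q + r) * x * y - of_int r * x\<^sup>2"
  using fps_quadratic_over_D[of "of_int p" "of_int q" "of_int r"]
  unfolding x_def y_def fps_of_int
  by (simp add: power2_eq_square algebra_simps)

text \<open>In the last three numerators the coefficients sum to 0, which removes the
  \<open>x * y\<close> term.\<close>

lemma sequences_fib:
  fixes n :: nat
  defines "x \<equiv> of_nat (fib n) :: rat" and "y \<equiv> of_nat (fib (Suc n))"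
  shows "a_seq n = 8 * y\<^sup>2 + 40 * x * y - 24 * x\<^sup>2"
    and "b_seq n = 6 * y\<^sup>2 - 44 * x * y - 18 * x\<^sup>2"
    and "c_seq n = 14 * y\<^sup>2 - 4 * x * y - 42 * x\<^sup>2"
    and "d_seq n = 9 * (3 * x\<^sup>2 + y\<^sup>2)"
    and "e_seq n = 4 * (3 * x\<^sup>2 + y\<^sup>2)"
    and "f_seq n = 15 * (3 * x\<^sup>2 + y\<^sup>2)"
  unfolding x_def y_def a_seq_def b_seq_def c_seq_def d_seq_def e_seq_def f_seq_def
  using fps_quadratic_over_D_nth[of 8 8 24 n] fps_quadratic_over_D_nth[of 6 "-68" 18 n]
    fps_quadratic_over_D_nth[of 14 "-60" 42 n] fps_quadratic_over_D_nth[of 9 18 "-27" n]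
    fps_quadratic_over_D_nth[of 4 8 "-12" n] fps_quadratic_over_D_nth[of 15 30 "-45" n]
  by simp_all

theorem theorem2p6:
  shows "(\<forall>n. a_seq n \<in> \<int> \<and> b_seq n \<in> \<int> \<and> c_seq n \<in> \<int> \<and>
              d_seq n \<in> \<int> \<and> e_seq n \<in> \<int> \<and> f_seq n \<in> \<int>) \<and>
         (\<forall>n. a_seq n ^ 4 + b_seq n ^ 4 + c_seq n ^ 4 + d_seq n ^ 4 + e_seq n ^ 4 = f_seq n ^ 4)"
proof (intro conjI allI)
  fix n
  show "a_seq n ^ 4 + b_seq n ^ 4 + c_seq n ^ 4 + d_seq n ^ 4 + e_seq n ^ 4 = f_seq n ^ 4"
    unfolding sequences_fib by algebra
\<comment> \<open>Integrality: the forms have integer coefficients and arguments.\<close>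
qed (simp_all add: sequences_fib)

end
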